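(* For every integer $n\ge0$ let $$P_n=P_n(q)=\sum_{j\ge0}\sum_{k\ge0}q^{j(j+1)/2+k}\begin{bmatrix} j+k\\ k\end{bmatrix}_{q^2}\begin{bmatrix} n-2k\\ j\end{bmatrix}_{q}.$$ Then $$P_n=\sum_{k=-\infty}^\infty\Big[q^{(21k^2+5k)/2}\,T_1(n+1,7k+1;\sqrt q)-q^{(21k+19)k/2+2}\,T_1(n+1,7k+3;\sqrt q)\Big],$$ and $P_0=1$, $P_1=q+1$, $P_2=q^3+q^2+2q+1$, and $P_n=(1+q^n)P_{n-1}+qP_{n-2}-qP_{n-3}$ for $n\ge3$.
   Context: $q$ is an indeterminate with a formal square root $\sqrt q$. $(a;p)_n=\prod_{i=0}^{n-1}(1-ap^i)$. The Gaussian polynomial in base $p$ is $\begin{bmatrix} A\\ B\end{bmatrix}_{p}=\frac{(p;p)_A}{(p;p)_B(p;p)_{A-B}}$ if $0\le B\le A$, and $0$ otherwise. For integers $L\ge0$ and $A$, $$T_1(L,A;q)=\sum_{r=0}^L(-q)^r\begin{bmatrix} L\\ r\end{bmatrix}_{q^2}\begin{bmatrix} 2L-2r\\ L-A-r\end{bmatrix}_{q},$$ and $T_1(L,A;\sqrt q)$ is obtained by replacing $q$ by $\sqrt q$. All sums have only finitely many nonzero terms. *)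

theory Defs
  imports
    "HOL-Computational_Algebra.Computational_Algebra"
    "HOL-Library.Groups_Big_Fun"
begin

definition qpoch :: "'a::field \<Rightarrow> 'a \<Rightarrow> nat \<Rightarrow> 'a" where
  "qpoch a p n = (\<Prod>i<n. 1 - a * p ^ i)"

text \<open>
  The first argument is the base. The quotient is taken in a field, so the definition is
  meaningful only when \<open>p\<close> is not a root of unity; below it is only used for
  positive powers of the indeterminate.
\<close>

definition gauss_binom :: "'a::field \<Rightarrow> int \<Rightarrow> int \<Rightarrow> 'a" where
  "gauss_binom p A B =
     (if 0 \<le> B \<and> B \<le> A
      then qpoch p p (nat A) / (qpoch p p (nat B) * qpoch p p (nat (A - B)))
      else 0)"

definition T1 :: "nat \<Rightarrow> int \<Rightarrow> 'a::field \<Rightarrow> 'a" where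
  "T1 L A q =
     (\<Sum>r=0..L. (- q) ^ r * gauss_binom (q\<^sup>2) (int L) (int r)
        * gauss_binom q (2 * int L - 2 * int r) (int L - A - int r))"

text \<open>
  \<open>Sum_any\<close> is the sum over a whole type of a family of finite support (and \<open>0\<close> if the
  support is infinite); the lemmas below show that all supports occurring here are finite.
\<close>

definition Pn :: "'a::field \<Rightarrow> nat \<Rightarrow> 'a" where
  "Pn q n =
     Sum_any (\<lambda>j::nat. Sum_any (\<lambda>k::nat.
       q ^ (j * (j + 1) div 2 + k) * gauss_binom (q\<^sup>2) (int (j + k)) (int k)
         * gauss_binom q (int n - 2 * int k) (int j)))"

definition sqrtq :: "rat poly fract" where
  "sqrtq = to_fract [:0, 1:]"

definition indet_q :: "rat poly fract" where
  "indet_q = sqrtq\<^sup>2"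

lemma Pn_finite_support_inner:
  "finite {k::nat. q ^ (j * (j + 1) div 2 + k) * gauss_binom (q\<^sup>2) (int (j + k)) (int k)
     * gauss_binom q (int n - 2 * int k) (int j) \<noteq> (0::'a::field)}"
  by (rule finite_subset[of _ "{..n}"]) (auto simp: gauss_binom_def split: if_splits)

lemma Pn_finite_support_outer:
  "finite {j::nat. Sum_any (\<lambda>k::nat.
     q ^ (j * (j + 1) div 2 + k) * gauss_binom (q\<^sup>2) (int (j + k)) (int k)
       * gauss_binom q (int n - 2 * int k) (int j)) \<noteq> (0::'a::field)}"
proof (rule finite_subset[of _ "{..n}"])
  have "Sum_any (\<lambda>k::nat.
     q ^ (j * (j + 1) div 2 + k) * gauss_binom (q\<^sup>2) (int (j + k)) (int k)
       * gauss_binom q (int n - 2 * int k) (int j)) = 0" if "j > n" for j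
  proof -
    have "gauss_binom q (int n - 2 * int k) (int j) = 0" for k
      using that by (auto simp: gauss_binom_def)
    then show ?thesis by simp
  qed
  then show "{j::nat. Sum_any (\<lambda>k::nat.
     q ^ (j * (j + 1) div 2 + k) * gauss_binom (q\<^sup>2) (int (j + k)) (int k)
       * gauss_binom q (int n - 2 * int k) (int j)) \<noteq> 0} \<subseteq> {..n}"
    by (auto simp flip: not_less)
qed simp

lemma T1_eq_0:
  assumes "\<bar>A\<bar> > int L"
  shows "T1 L A q = 0"
  unfolding T1_def using assms by (intro sum.neutral) (auto simp: gauss_binom_def)

lemma T1_sum_finite_support:
  "finite {k::int. c k * T1 L (7 * k + 1) q - d k * T1 L (7 * k + 3) q \<noteq> (0::'a::field)}"
proof (rule finite_subset[of _ "{- int L - 3..int L + 3}"])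
  show "{k::int. c k * T1 L (7 * k + 1) q - d k * T1 L (7 * k + 3) q \<noteq> 0}
     \<subseteq> {- int L - 3..int L + 3}"
  proof
    fix k :: int
    assume k: "k \<in> {k. c k * T1 L (7 * k + 1) q - d k * T1 L (7 * k + 3) q \<noteq> 0}"
    show "k \<in> {- int L - 3..int L + 3}"
    proof (rule ccontr)
      assume "\<not> ?thesis"
      then have "\<bar>7 * k + 1\<bar> > int L" "\<bar>7 * k + 3\<bar> > int L" by auto
      then show False using k by (simp add: T1_eq_0)
    qed
  qed
qed simp

end

theory Submission
  imports Defs
begin

text \<open>
  Write \<open>s\<close> for \<open>sqrt q\<close>. Both sides are shown to satisfy the same third-order recurrence in \<open>n\<close> and
  to have the same first three values.

  For the double sum \<open>P_n\<close> the recurrence comes from the generating function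
  \<open>F(x) = (\<Sum>n. P_n x^n) = (\<Sum>j. q^(j(j+1)/2) x^j / ((x;q)_(j+1) (q x^2;q^2)_(j+1)))\<close>.
  Multiplying the \<open>j\<close>-th summand by \<open>(1 - x)(1 - q x^2)\<close> gives \<open>q x\<close> times the \<open>(j-1)\<close>-st summand
  at \<open>q x\<close>, so that \<open>(1 - x)(1 - q x^2) F(x) = 1 + q x F(q x)\<close>, which is the recurrence. The lemma
  \<open>fermi_term_rec\<close> is this computation on coefficients, with the Pascal rules for Gaussian
  polynomials in place of the two factors.

  For the \<open>T1\<close> side let \<open>T0\<close> be the sum \<open>T1\<close> with \<open>(-1)^r\<close> for \<open>(-q)^r\<close>. The two families satisfy
  three contiguous relations (\<open>T1_Suc\<close>, \<open>T0_Suc\<close>, \<open>T1_T0_consecutive\<close>), with coefficients that are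
  monomials in \<open>s\<close>, \<open>s^L\<close> and \<open>s^A\<close>. A factor \<open>s^A\<close> and a shift of \<open>A\<close> act on sums of the form
  \<open>\<Theta>(a,b;f) = (\<Sum>k. s^(21 k^2 + b k) f(7k + a))\<close> just by changing \<open>a\<close> and \<open>b\<close>. The sum of the
  theorem is \<open>\<Phi>(n+1)\<close> with \<open>\<Phi>(L) = \<Theta>(1,5;T1 L) - s^4 \<Theta>(3,19;T1 L)\<close>. With
  \<open>G(L) = \<Theta>(0,-2;T0 L) - s^8 \<Theta>(4,26;T0 L)\<close> the contiguous relations yield, after cancellations
  between the two parts of each sum,
  \<open>\<Phi>(L+1) = \<Phi>(L) + s^L G(L)\<close> and \<open>G(L+2) = G(L) + s^(L+2) \<Phi>(L+2)\<close>,
  and eliminating \<open>G\<close> leaves the recurrence of \<open>P_n\<close>. In the code \<open>\<Phi>\<close> is \<open>bose\<close> and \<open>G\<close> is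
  \<open>bose_T0\<close>. Everything holds over any field in which \<open>s\<close> is nonzero and not a root of unity; only
  the last step specializes to the indeterminate.
\<close>

section \<open>Gaussian polynomials\<close>

definition generic :: "'a::field \<Rightarrow> bool" where
  "generic p \<longleftrightarrow> p \<noteq> 0 \<and> (\<forall>n>0. p ^ n \<noteq> 1)"

lemma generic_nonzero: "generic p \<Longrightarrow> p \<noteq> 0"
  by (simp add: generic_def)

lemma generic_power2: "generic p \<Longrightarrow> generic (p\<^sup>2)"
  by (simp add: generic_def flip: power_mult)

lemma generic_powi: "generic p \<Longrightarrow> n > 0 \<Longrightarrow> p powi n \<noteq> 1"
  by (simp add: generic_def power_int_def)

lemma qpoch_Suc: "qpoch a p (Suc n) = qpoch a p n * (1 - a * p ^ n)"
  by (simp add: qpoch_def)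

lemma qpoch_generic_nonzero: "generic p \<Longrightarrow> qpoch p p n \<noteq> 0"
  by (auto simp: qpoch_def generic_def simp flip: power_Suc)

lemma gauss_binom_outside: "B < 0 \<or> A < B \<Longrightarrow> gauss_binom p A B = 0"
  by (auto simp: gauss_binom_def)

lemma gauss_binom_0 [simp]: "generic p \<Longrightarrow> A \<ge> 0 \<Longrightarrow> gauss_binom p A 0 = 1"
  by (simp add: gauss_binom_def qpoch_generic_nonzero qpoch_def[of _ _ 0])

lemma gauss_binom_self [simp]: "generic p \<Longrightarrow> A \<ge> 0 \<Longrightarrow> gauss_binom p A A = 1"
  by (simp add: gauss_binom_def qpoch_generic_nonzero qpoch_def[of _ _ 0])

lemma gauss_binom_sym: "gauss_binom p A (A - B) = gauss_binom p A B"
  by (simp add: gauss_binom_def mult.commute)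

text \<open>
  Letting all integers occur as \<open>A\<close> and \<open>B\<close> saves the boundary cases in every later application:
  outside the triangle either the Gaussian polynomials or the linear factors vanish.
\<close>

lemma gauss_binom_absorb:
  assumes "generic p"
  shows "(1 - p powi B) * gauss_binom p A B = (1 - p powi A) * gauss_binom p (A - 1) (B - 1)"
proof (cases "1 \<le> B \<and> B \<le> A")
  case True
  define a where "a = nat (A - 1)"
  define b where "b = nat (B - 1)"
  have A: "nat A = Suc a" "nat (A - 1) = a" "p powi A = p * p ^ a"
    and B: "nat B = Suc b" "nat (B - 1) = b" "p powi B = p * p ^ b"
    and AB: "nat (A - B) = a - b" "A - 1 - (B - 1) = A - B"
    using True by (auto simp: a_def b_def power_int_def nat_diff_distrib simp flip: power_Suc
        intro!: arg_cong[of _ _ "\<lambda>n. p ^ n"])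
  have nz: "1 - p * p ^ b \<noteq> 0"
    using assms by (auto simp: generic_def simp flip: power_Suc)
  show ?thesis
    using True nz qpoch_generic_nonzero[OF assms]
    by (simp add: gauss_binom_def A B AB qpoch_Suc field_simps)
next
  case False
  then consider "B < 0" | "B = 0" | "A < B" "B > 0" by linarith
  then show ?thesis
    by cases (auto simp: gauss_binom_def)
qed

lemma gauss_binom_absorb':
  assumes "generic p"
  shows "(1 - p powi (A - B)) * gauss_binom p A B = (1 - p powi A) * gauss_binom p (A - 1) B"
  using gauss_binom_absorb[OF assms, of "A - B" A] gauss_binom_sym[of p A B]
    gauss_binom_sym[of p "A - 1" B]
  by (simp add: algebra_simps)

text \<open>
  The Pascal rule follows from the two absorption rules after multiplication by \<open>1 - p^A\<close>. For
  \<open>A = B = 0\<close> it fails, which is why \<open>A \<ge> 1\<close> is assumed.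
\<close>

lemma gauss_binom_pascal:
  assumes "generic p" "A \<ge> 1"
  shows "gauss_binom p A B
    = gauss_binom p (A - 1) B + p powi (A - B) * gauss_binom p (A - 1) (B - 1)"
proof -
  have *: "p powi A = p powi (A - B) * p powi B"
    using generic_nonzero[OF assms(1)] by (simp flip: power_int_add)
  have "(1 - p powi A) * gauss_binom p A B
      = (1 - p powi A) * (gauss_binom p (A - 1) B + p powi (A - B) * gauss_binom p (A - 1) (B - 1))"
    using gauss_binom_absorb[OF assms(1), of B A] gauss_binom_absorb'[OF assms(1), of A B]
    unfolding * by algebra
  moreover have "1 - p powi A \<noteq> 0"
    using generic_powi[of p A] assms by simp
  ultimately show ?thesis by simp
qed

lemma gauss_binom_pascal':
  assumes "generic p" "A \<ge> 1"
  shows "gauss_binom p A B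
    = gauss_binom p (A - 1) (B - 1) + p powi B * gauss_binom p (A - 1) B"
  using gauss_binom_pascal[OF assms, of "A - B"] gauss_binom_sym[of p A B]
    gauss_binom_sym[of p "A - 1" B] gauss_binom_sym[of p "A - 1" "B - 1"]
  by (simp add: algebra_simps)

text \<open>
  Pascal's rule and absorption as summation by parts: they move a change of the upper index, or a
  factor \<open>1 - p^r\<close>, onto an arbitrary weight \<open>g\<close>. In this form they apply to \<open>T0\<close> and \<open>T1\<close> alike.
\<close>

lemma gauss_binom_sum_Suc:
  assumes "generic p"
  shows "(\<Sum>r\<le>Suc L. gauss_binom p (int (Suc L)) (int r) * g r)
    = (\<Sum>r\<le>L. gauss_binom p (int L) (int r) * (g r + p ^ (L - r) * g (Suc r)))"
proof -
  have "(\<Sum>r\<le>Suc L. gauss_binom p (int (Suc L)) (int r) * g r)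
      = (\<Sum>r\<le>Suc L. gauss_binom p (int L) (int r) * g r)
        + (\<Sum>r\<le>Suc L. p powi (int (Suc L) - int r) * gauss_binom p (int L) (int r - 1) * g r)"
    unfolding sum.distrib[symmetric]
    using gauss_binom_pascal[OF assms, of "int (Suc L)"]
    by (intro sum.cong) (simp_all add: algebra_simps)
  also have "(\<Sum>r\<le>Suc L. gauss_binom p (int L) (int r) * g r)
      = (\<Sum>r\<le>L. gauss_binom p (int L) (int r) * g r)"
    by (simp add: gauss_binom_outside)
  also have "(\<Sum>r\<le>Suc L. p powi (int (Suc L) - int r) * gauss_binom p (int L) (int r - 1) * g r)
      = (\<Sum>r\<le>L. p powi (int L - int r) * gauss_binom p (int L) (int r) * g (Suc r))"
    by (subst sum.atMost_Suc_shift) (simp add: gauss_binom_outside)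
  also have "\<dots> = (\<Sum>r\<le>L. gauss_binom p (int L) (int r) * (p ^ (L - r) * g (Suc r)))"
    by (intro sum.cong) (auto simp: power_int_def nat_diff_distrib simp flip: of_nat_diff)
  finally show ?thesis
    by (simp add: algebra_simps sum.distrib)
qed

lemma gauss_binom_sum_absorb:
  assumes "generic p"
  shows "(\<Sum>r\<le>L. gauss_binom p (int L) (int r) * ((1 - p ^ r) * g r))
    = (\<Sum>r\<le>L. gauss_binom p (int L) (int r) * ((1 - p ^ (L - r)) * g (Suc r)))"
proof (cases L)
  case (Suc M)
  have 1: "gauss_binom p (int L) (int (Suc r)) * (1 - p ^ Suc r)
      = gauss_binom p (int L) (int r) * (1 - p ^ (L - r))" if "r \<le> M" for r
  proof -
    have "int L - int r = int (L - r)" "int (Suc r) - 1 = int r" using that Suc by simp_all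
    then show ?thesis
      using gauss_binom_absorb[OF assms, of "int (Suc r)" "int L"]
        gauss_binom_absorb'[OF assms, of "int L" "int r"]
      by (simp only: power_int_of_nat mult.commute)
  qed
  have "(\<Sum>r\<le>L. gauss_binom p (int L) (int r) * ((1 - p ^ r) * g r))
      = (\<Sum>r\<le>M. gauss_binom p (int L) (int (Suc r)) * (1 - p ^ Suc r) * g (Suc r))"
    unfolding Suc by (subst sum.atMost_Suc_shift) (simp add: mult.assoc)
  also have "\<dots> = (\<Sum>r\<le>M. gauss_binom p (int L) (int r) * (1 - p ^ (L - r)) * g (Suc r))"
    by (intro sum.cong refl) (simp only: 1 atMost_iff)
  finally show ?thesis
    by (simp add: Suc mult.assoc)
qed simp

section \<open>Contiguous relations for q-trinomial coefficients\<close>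

definition T0 :: "nat \<Rightarrow> int \<Rightarrow> 'a::field \<Rightarrow> 'a" where
  "T0 L A q =
     (\<Sum>r\<le>L. gauss_binom (q\<^sup>2) (int L) (int r)
        * ((- 1) ^ r * gauss_binom q (2 * (int L - int r)) (int L - int r - A)))"

lemma T1_alt:
  "T1 L A q =
     (\<Sum>r\<le>L. gauss_binom (q\<^sup>2) (int L) (int r)
        * ((- 1) ^ r * q ^ r * gauss_binom q (2 * (int L - int r)) (int L - int r - A)))"
proof -
  have "(- q) ^ r = (- 1) ^ r * q ^ r" for r
    by (rule power_minus)
  then show ?thesis
    unfolding T1_def atLeast0AtMost
    by (intro sum.cong refl) (simp add: algebra_simps)
qed

lemma T0_minus: "T0 L (- A) q = T0 L A q"
proof -
  have "gauss_binom q (2 * m) (m + A) = gauss_binom q (2 * m) (m - A)" for m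
    using gauss_binom_sym[of q "2 * m" "m - A"] by (simp add: algebra_simps)
  then have "gauss_binom q (2 * m) (m - - A) = gauss_binom q (2 * m) (m - A)" for m
    by simp
  then show ?thesis unfolding T0_def by (simp only:)
qed

lemma T1_minus: "T1 L (- A) q = T1 L A q"
proof -
  have "gauss_binom q (2 * m) (m + A) = gauss_binom q (2 * m) (m - A)" for m
    using gauss_binom_sym[of q "2 * m" "m - A"] by (simp add: algebra_simps)
  then have "gauss_binom q (2 * m) (m - - A) = gauss_binom q (2 * m) (m - A)" for m
    by simp
  then show ?thesis unfolding T1_alt by (simp only:)
qed

lemma T0_eq_0: "\<bar>A\<bar> > int L \<Longrightarrow> T0 L A q = 0"
  unfolding T0_def by (intro sum.neutral) (auto simp: gauss_binom_def)

lemma powi_nat_mult: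
  assumes "q \<noteq> (0 :: 'a :: field)"
  shows "q ^ r * q powi i = q powi (int r + i)"
  using assms by (simp add: power_int_add)

text \<open>
  This relation holds summand by summand: with \<open>m = L - r\<close> both sides reduce to
  \<open>(1 - q^(m-A)) [2m, m-A] = (1 - q^(m+A+1)) [2m, m-A-1]\<close>.
\<close>

lemma T1_T0_consecutive:
  assumes "generic q"
  shows "T1 L A q - T1 L (A + 1) q
    = q powi (int L - A) * T0 L A q - q powi (int L + A + 1) * T0 L (A + 1) q"
proof -
  note nz = generic_nonzero[OF assms]
  have *: "q ^ r * gauss_binom q (2 * (int L - int r)) (int L - int r - A)
      - q ^ r * gauss_binom q (2 * (int L - int r)) (int L - int r - (A + 1))
     = q powi (int L - A) * gauss_binom q (2 * (int L - int r)) (int L - int r - A)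
      - q powi (int L + A + 1) * gauss_binom q (2 * (int L - int r)) (int L - int r - (A + 1))" for r
  proof -
    define m where "m = int L - int r"
    have "(1 - q powi (m - A)) * gauss_binom q (2 * m) (m - A)
        = (1 - q powi (m + A + 1)) * gauss_binom q (2 * m) (m - (A + 1))"
    proof -
      have "m - A - 1 = m - (A + 1)" "2 * m - (m - (A + 1)) = m + A + 1" by simp_all
      then show ?thesis
        using gauss_binom_absorb[OF assms, of "m - A" "2 * m"]
          gauss_binom_absorb'[OF assms, of "2 * m" "m - (A + 1)"]
        by (simp only:)
    qed
    moreover have "q powi (int L - A) = q ^ r * q powi (m - A)"
      "q powi (int L + A + 1) = q ^ r * q powi (m + A + 1)"
      using nz by (simp_all add: powi_nat_mult m_def algebra_simps)
    moreover define u where "u = q ^ r"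
    ultimately show ?thesis
      unfolding m_def[symmetric] u_def[symmetric] by algebra
  qed
  show ?thesis
    unfolding T1_alt T0_def sum_distrib_left sum_subtractf[symmetric]
  proof (intro sum.cong refl, goal_cases)
    case (1 r)
    define u e b where "u = q ^ r" and "e = (- 1 :: 'a) ^ r"
      and "b = gauss_binom (q\<^sup>2) (int L) (int r)"
    show ?case
      using *[of r] unfolding u_def[symmetric] e_def[symmetric] b_def[symmetric] by algebra
  qed
qed

text \<open>
  After the upper index of the base-\<open>q^2\<close> factor has been lowered, the relation holds summand by
  summand, by applying Pascal's rule twice to \<open>[2m+2, k]\<close>.
\<close>

lemma T1_Suc:
  assumes "generic q"
  shows "T1 (Suc L) A q = T1 L A q + q powi (int (Suc L) + A) * T0 L (A + 1) q
    + q powi (int (Suc L) - A) * T0 L (A - 1) q"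
proof -
  note nz = generic_nonzero[OF assms]
  show ?thesis
    unfolding T1_alt T0_def gauss_binom_sum_Suc[OF generic_power2[OF assms]]
      sum_distrib_left sum.distrib[symmetric]
  proof (intro sum.cong refl, goal_cases)
    case (1 r)
    define m where "m = int L - int r"
    have m0: "m \<ge> 0" using 1 by (simp add: m_def)
    have "2 * m = int (2 * (L - r))" using 1 by (simp add: m_def)
    then have P: "(q\<^sup>2) ^ (L - r) = q powi (2 * m)"
      by (simp only: power_int_of_nat power_mult)
    have E: "q powi (int (Suc L) + A) = q ^ r * q powi (m + 1 + A)"
      "q powi (int (Suc L) - A) = q ^ r * q powi (m + 1 - A)"
      using nz by (simp_all add: powi_nat_mult m_def algebra_simps)
    define k where "k = m + 1 - A"
    have "gauss_binom q (2 * m + 2) k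
        = gauss_binom q (2 * m + 1) (k - 1) + q powi k * gauss_binom q (2 * m + 1) k"
      using gauss_binom_pascal'[OF assms, of "2 * m + 2" k] m0 by (simp add: algebra_simps)
    moreover have "gauss_binom q (2 * m + 1) (k - 1)
        = gauss_binom q (2 * m) (k - 1) + q powi (m + 1 + A) * gauss_binom q (2 * m) (k - 2)"
      using gauss_binom_pascal[OF assms, of "2 * m + 1" "k - 1"] m0
      by (simp add: algebra_simps k_def)
    moreover have "gauss_binom q (2 * m + 1) k
        = gauss_binom q (2 * m) k + q powi (m + A) * gauss_binom q (2 * m) (k - 1)"
      using gauss_binom_pascal[OF assms, of "2 * m + 1" k] m0
      by (simp add: algebra_simps k_def)
    moreover have "q powi k * q powi (m + A) = q * q powi (2 * m)"
      using nz by (simp add: k_def power_int_add_1' flip: power_int_add)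
    moreover have "q powi (m + 1 - A) = q powi k" by (simp add: k_def)
    ultimately have *: "gauss_binom q (2 * m + 2) k - q * q powi (2 * m) * gauss_binom q (2 * m) (k - 1)
      = gauss_binom q (2 * m) (k - 1) + q powi (m + 1 + A) * gauss_binom q (2 * m) (k - 2)
        + q powi (m + 1 - A) * gauss_binom q (2 * m) k"
      by algebra
    have I: "2 * (int (Suc L) - int r) = 2 * m + 2" "int (Suc L) - int r - A = k"
      "2 * (int (Suc L) - int (Suc r)) = 2 * m" "int (Suc L) - int (Suc r) - A = k - 1"
      "int L - int r = m" "m - A = k - 1" "m - (A + 1) = k - 2" "m - (A - 1) = k"
      by (simp_all add: m_def k_def)
    define u e b where "u = q ^ r" and "e = (- 1 :: 'a) ^ r"
      and "b = gauss_binom (q\<^sup>2) (int L) (int r)"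
    show ?case
      unfolding P E I power_Suc u_def[symmetric] e_def[symmetric] b_def[symmetric]
      using * by algebra
  qed
qed

text \<open>
  Here the summands do not agree individually. Their difference is
  \<open>(1 - q^(2r)) h(r) - (1 - q^(2(L-r))) h(r+1)\<close> times \<open>[L, r]\<close> in base \<open>q^2\<close>, for the function \<open>h\<close> of
  the proof, and this sums to zero by absorption.
\<close>

lemma T0_Suc:
  assumes "generic q"
  shows "T0 (Suc L) A q = T0 L (A - 1) q + q powi (int (Suc L) + A) * T1 L A q
    + q powi (2 * (int (Suc L) + A)) * T0 L (A + 1) q"
proof -
  note nz = generic_nonzero[OF assms]
  define h where "h r = (-1) ^ r * (q powi (int L - int r + 1 + A)
      * gauss_binom q (2 * (int L - int r) + 1) (int L - int r - A))" for r :: nat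
  have "T0 (Suc L) A q - (T0 L (A - 1) q + q powi (int (Suc L) + A) * T1 L A q
    + q powi (2 * (int (Suc L) + A)) * T0 L (A + 1) q)
    = (\<Sum>r\<le>L. gauss_binom (q\<^sup>2) (int L) (int r) * ((1 - (q\<^sup>2) ^ r) * h r))
     - (\<Sum>r\<le>L. gauss_binom (q\<^sup>2) (int L) (int r) * ((1 - (q\<^sup>2) ^ (L - r)) * h (Suc r)))"
    unfolding T1_alt T0_def gauss_binom_sum_Suc[OF generic_power2[OF assms]]
      sum_distrib_left sum.distrib[symmetric] sum_subtractf[symmetric]
  proof (intro sum.cong refl, goal_cases)
    case (1 r)
    define m where "m = int L - int r"
    have m0: "m \<ge> 0" using 1 by (simp add: m_def)
    have "2 * m = int (2 * (L - r))" using 1 by (simp add: m_def)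
    then have P: "(q\<^sup>2) ^ (L - r) = q powi (2 * m)"
      by (simp only: power_int_of_nat power_mult)
    define k where "k = m + 1 - A"
    define c where "c = m + A"
    have Q: "(q\<^sup>2) ^ r = q ^ r * q ^ r"
      by (simp add: power2_eq_square power_mult_distrib)
    have c1: "q powi (c + 1) = q * q powi c"
      using nz by (simp add: power_int_add)
    have E1: "q powi (int (Suc L) + A) = q ^ r * (q * q powi c)"
      using nz by (simp add: c1[symmetric] powi_nat_mult) (simp add: c_def m_def algebra_simps)
    have "q powi (2 * (int (Suc L) + A)) = (q powi (int (Suc L) + A))\<^sup>2"
      unfolding power2_eq_square using power_int_add[of q "int (Suc L) + A" "int (Suc L) + A"] nz
      by (simp only: mult_2 simp_thms)
    note E = E1 this[unfolded E1]
    have E': "q powi (m + 1 + A) = q * q powi c" "q powi (m - 1 + 1 + A) = q powi c"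
      using c1 by (simp_all add: c_def algebra_simps)
    have "gauss_binom q (2 * m + 2) k
        = gauss_binom q (2 * m + 1) k + q * q powi c * gauss_binom q (2 * m + 1) (k - 1)"
      using gauss_binom_pascal[OF assms, of "2 * m + 2" k] m0 nz
      by (simp add: algebra_simps k_def c_def power_int_add)
    moreover have p2: "gauss_binom q (2 * m + 1) (k - 1)
        = gauss_binom q (2 * m) (k - 1) + q * q powi c * gauss_binom q (2 * m) (k - 2)"
      using gauss_binom_pascal[OF assms, of "2 * m + 1" "k - 1"] m0 nz
      by (simp add: algebra_simps k_def c_def power_int_add)
    moreover have "gauss_binom q (2 * m + 1) k
        = gauss_binom q (2 * m) k + q powi c * gauss_binom q (2 * m) (k - 1)"
      using gauss_binom_pascal[OF assms, of "2 * m + 1" k] m0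
      by (simp add: algebra_simps k_def c_def)
    moreover have "(q powi c - q powi (2 * m)) * gauss_binom q (2 * m) (k - 1)
       = q powi c * (1 - q powi (2 * m)) * gauss_binom q (2 * m - 1) (k - 2)"
    proof -
      have "q powi (2 * m) = q powi c * q powi (k - 1)"
        using nz by (simp add: c_def k_def flip: power_int_add)
      then have "(q powi c - q powi (2 * m)) * gauss_binom q (2 * m) (k - 1)
        = q powi c * ((1 - q powi (k - 1)) * gauss_binom q (2 * m) (k - 1))"
        by (simp add: algebra_simps)
      also have "(1 - q powi (k - 1)) * gauss_binom q (2 * m) (k - 1)
        = (1 - q powi (2 * m)) * gauss_binom q (2 * m - 1) (k - 2)"
        using gauss_binom_absorb[OF assms, of "k - 1" "2 * m"] by simp
      finally show ?thesis by (simp only: mult.assoc)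
    qed
    ultimately have *: "gauss_binom q (2 * m + 2) k - q powi (2 * m) * gauss_binom q (2 * m) (k - 1)
      = gauss_binom q (2 * m) k + q * q powi c * gauss_binom q (2 * m + 1) (k - 1)
        + q powi c * (1 - q powi (2 * m)) * gauss_binom q (2 * m - 1) (k - 2)"
      by algebra
    have I: "2 * (int (Suc L) - int r) = 2 * m + 2" "int (Suc L) - int r - A = k"
      "2 * (int (Suc L) - int (Suc r)) = 2 * m" "int (Suc L) - int (Suc r) - A = k - 1"
      "int L - int r = m" "m - A = k - 1" "m - (A + 1) = k - 2" "m - (A - 1) = k"
      "int L - int (Suc r) = m - 1" "m - 1 - A = k - 2" "2 * (m - 1) + 1 = 2 * m - 1"
      by (simp_all add: m_def k_def)
    define u e b where "u = q ^ r" and "e = (- 1 :: 'a) ^ r"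
      and "b = gauss_binom (q\<^sup>2) (int L) (int r)"
    show ?case
      unfolding P Q h_def E I E' power_Suc u_def[symmetric] e_def[symmetric] b_def[symmetric]
      using * p2 by algebra
  qed
  also have "\<dots> = 0"
    by (simp add: gauss_binom_sum_absorb[OF generic_power2[OF assms], of L h])
  finally show ?thesis by simp
qed

text \<open>
  A combination of the three relations in which all values \<open>T1 L\<close> are eliminated in favour of a
  single \<open>T1 (Suc L)\<close>. In the theta sums below the last term cancels, and what remains is
  the coupling of \<open>T0\<close> with \<open>T1\<close> at equal \<open>L\<close>.
\<close>

lemma T0_Suc_T1_Suc:
  assumes "generic q"
  shows "T0 (Suc L) A q = q powi (int (Suc L) + A) * T1 (Suc L) (A + 1) q
    + T0 L (A - 1) q - q powi (2 * (int (Suc L) + A) + 1) * T0 L (A + 2) q"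
proof -
  note nz = generic_nonzero[OF assms]
  define B where "B = int (Suc L) + A"
  define x where "x = q powi B"
  have E: "q powi (2 * B) = x * x" "q powi (B + 1) = x * q"
    unfolding x_def using nz power_int_add[of q B B] by (simp_all add: power_int_add_1)
  have E': "q powi (2 * B + 1) = x * x * q"
    using nz by (simp add: power_int_add_1 E)
  have I: "int (Suc L) + (A + 1) = B + 1" "int L + A + 1 = B"
    by (simp_all add: B_def)
  have "T1 L (A + 1) q = T1 L A q - q powi (int L - A) * T0 L A q + x * T0 L (A + 1) q"
    using T1_T0_consecutive[OF assms, of L A] unfolding I x_def by (simp add: algebra_simps)
  moreover have "T1 (Suc L) (A + 1) q = T1 L (A + 1) q + x * q * T0 L (A + 2) q
      + q powi (int L - A) * T0 L A q"
    using T1_Suc[OF assms, of L "A + 1"] unfolding I E by (simp add: algebra_simps)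
  ultimately show ?thesis
    using T0_Suc[OF assms, of L A] unfolding B_def[symmetric] E E' x_def[symmetric] by algebra
qed

section \<open>Theta sums modulo 7\<close>

definition theta :: "'a::field \<Rightarrow> int \<Rightarrow> int \<Rightarrow> (int \<Rightarrow> 'a) \<Rightarrow> 'a" where
  "theta s a b f = Sum_any (\<lambda>k::int. s powi (21 * k\<^sup>2 + b * k) * f (7 * k + a))"

lemma theta_finite_support:
  fixes f :: "int \<Rightarrow> 'a::field"
  assumes "finite {A. f A \<noteq> 0}"
  shows "finite {k. s powi e k * f (7 * k + a) \<noteq> 0}"
proof (rule finite_subset)
  show "finite ((\<lambda>k. 7 * k + a) -` {A. f A \<noteq> 0})"
    by (intro finite_vimageI assms injI) simp
qed auto

lemma theta_minus:
  assumes "\<And>A. f (- A) = f A"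
  shows "theta s (- a) (- b) f = theta s a b f"
  unfolding theta_def
proof (rule Sum_any.reindex_cong[of uminus])
  show "bij (uminus :: int \<Rightarrow> int)"
    by (rule o_bij[of uminus]) auto
  have "f (- (7 * k) + - a) = f (7 * k + a)" for k
    using assms[of "7 * k + a"] by simp
  then show "(\<lambda>k. s powi (21 * k\<^sup>2 + - b * k) * f (7 * k + - a)) \<circ> uminus
      = (\<lambda>k. s powi (21 * k\<^sup>2 + b * k) * f (7 * k + a))"
    by (simp add: fun_eq_iff)
qed

text \<open>The same sum in terms of \<open>k + 1\<close>; it brings the residue \<open>a\<close> back into a fixed range.\<close>

lemma theta_period:
  assumes "s \<noteq> 0" "finite {A. f A \<noteq> (0::'a::field)}"
  shows "theta s a b f = s powi (21 + b) * theta s (a + 7) (b + 42) f"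
proof -
  have "theta s a b f
      = Sum_any (\<lambda>k. s powi (21 + b) * (s powi (21 * k\<^sup>2 + (b + 42) * k) * f (7 * k + (a + 7))))"
    unfolding theta_def
  proof (rule Sum_any.reindex_cong[of "\<lambda>k. k + 1"])
    show "bij (\<lambda>k::int. k + 1)"
      by (rule o_bij[of "\<lambda>k. k - 1"]) auto
    show "(\<lambda>k. s powi (21 * k\<^sup>2 + b * k) * f (7 * k + a)) \<circ> (\<lambda>k. k + 1)
      = (\<lambda>k. s powi (21 + b) * (s powi (21 * k\<^sup>2 + (b + 42) * k) * f (7 * k + (a + 7))))"
      using assms(1)
      by (simp add: fun_eq_iff power2_eq_square algebra_simps flip: power_int_add mult.assoc)
  qed
  also have "\<dots> = s powi (21 + b) * theta s (a + 7) (b + 42) f"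
    unfolding theta_def by (intro Sum_any_right_distrib[symmetric] theta_finite_support assms(2))
  finally show ?thesis .
qed

text \<open>
  The reason for working with this family: since \<open>s^(i (7k + a)) = s^(i a) s^(7 i k)\<close>, a factor
  \<open>s^(i A)\<close> is absorbed by \<open>b\<close>, and a shift of \<open>A\<close> by \<open>a\<close>. Every contiguous relation has three terms on
  the right, and thus turns into a relation among theta sums.
\<close>

lemma theta_linear:
  assumes "s \<noteq> (0::'a::field)"
    and "finite {A. g A \<noteq> 0}" "finite {A. h A \<noteq> 0}" "finite {A. u A \<noteq> 0}"
    and f: "\<And>A. f A = c * (s powi (i * A) * g (A + x)) + d * (s powi (j * A) * h (A + y))
      + e * (s powi (l * A) * u (A + z))"
  shows "theta s a b f = c * (s powi (i * a) * theta s (a + x) (b + 7 * i) g)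
    + d * (s powi (j * a) * theta s (a + y) (b + 7 * j) h)
    + e * (s powi (l * a) * theta s (a + z) (b + 7 * l) u)"
proof -
  define t where "t i v x k = s powi (21 * k\<^sup>2 + (b + 7 * i) * k) * v (7 * k + (a + x))"
    for i x k :: int and v :: "int \<Rightarrow> 'a"
  have fin: "finite {k. t i v x k \<noteq> 0}" if "finite {A. v A \<noteq> 0}" for i v x
    using theta_finite_support[OF that] by (simp add: t_def)
  have fin': "finite {k. c' * t i v x k \<noteq> 0}" if "finite {A. v A \<noteq> 0}" for i v x c'
    by (rule finite_subset[OF _ fin[OF that, of i x]]) auto
  have th: "c' * (s powi (i * a) * theta s (a + x) (b + 7 * i) v)
      = Sum_any (\<lambda>k. c' * s powi (i * a) * t i v x k)" if "finite {A. v A \<noteq> 0}" for i v x c'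
    unfolding theta_def mult.assoc[symmetric]
    using Sum_any_right_distrib[OF fin[OF that, of i x], of "c' * s powi (i * a)"]
    by (simp add: t_def)
  have tw: "s powi (21 * k\<^sup>2 + b * k) * (c' * (s powi (i * (7 * k + a)) * v (7 * k + a + x)))
      = c' * s powi (i * a) * t i v x k" for i v x c' k
  proof -
    have "s powi (21 * k\<^sup>2 + b * k) * s powi (i * (7 * k + a))
        = s powi (i * a) * s powi (21 * k\<^sup>2 + (b + 7 * i) * k)"
      using assms(1) by (simp add: algebra_simps flip: power_int_add)
    then show ?thesis by (simp add: t_def algebra_simps)
  qed
  have "s powi (21 * k\<^sup>2 + b * k) * f (7 * k + a) = c * s powi (i * a) * t i g x k
      + d * s powi (j * a) * t j h y k + e * s powi (l * a) * t l u z k" for k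
    unfolding f distrib_left[of "s powi (21 * k\<^sup>2 + b * k)"] tw ..
  then have "theta s a b f = Sum_any (\<lambda>k. c * s powi (i * a) * t i g x k
      + d * s powi (j * a) * t j h y k + e * s powi (l * a) * t l u z k)"
    unfolding theta_def by (intro Sum_any.cong)
  also have "\<dots> = Sum_any (\<lambda>k. c * s powi (i * a) * t i g x k)
      + Sum_any (\<lambda>k. d * s powi (j * a) * t j h y k) + Sum_any (\<lambda>k. e * s powi (l * a) * t l u z k)"
  proof -
    have "finite {k. c * s powi (i * a) * t i g x k + d * s powi (j * a) * t j h y k \<noteq> 0}"
      by (rule finite_subset[OF _ finite_UnI[OF fin[OF assms(2), of i x] fin[OF assms(3), of j y]]]) auto
    from Sum_any.distrib[OF this fin'[OF assms(4), where c' = "e * s powi (l * a)" and i = l and x = z]]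
      Sum_any.distrib[OF fin'[OF assms(2), where c' = "c * s powi (i * a)" and i = i and x = x]
        fin'[OF assms(3), where c' = "d * s powi (j * a)" and i = j and x = y]]
    show ?thesis by (simp only:)
  qed
  finally show ?thesis by (simp add: th assms)
qed

abbreviation theta0 :: "'a::field \<Rightarrow> nat \<Rightarrow> int \<Rightarrow> int \<Rightarrow> 'a" where
  "theta0 s L a b \<equiv> theta s a b (\<lambda>A. T0 L A s)"

abbreviation theta1 :: "'a::field \<Rightarrow> nat \<Rightarrow> int \<Rightarrow> int \<Rightarrow> 'a" where
  "theta1 s L a b \<equiv> theta s a b (\<lambda>A. T1 L A s)"

lemma T0_finite_support: "finite {A. T0 L A s \<noteq> 0}"
  by (rule finite_subset[of _ "{- int L..int L}"]) (use T0_eq_0 in \<open>force simp flip: not_less\<close>)+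

lemma T1_finite_support: "finite {A. T1 L A s \<noteq> 0}"
  by (rule finite_subset[of _ "{- int L..int L}"]) (use T1_eq_0 in \<open>force simp flip: not_less\<close>)+

lemmas finite_supports = T0_finite_support T1_finite_support

section \<open>The recurrence for the sum over \<open>T1\<close>\<close>

context
  fixes s :: "'a::field"
  assumes s: "generic s"
begin

lemma s_nonzero: "s \<noteq> 0"
  using s by (rule generic_nonzero)

lemma theta1_Suc:
  "theta1 s (Suc L) a b = theta1 s L a b
    + s ^ Suc L * (s powi a * theta0 s L (a + 1) (b + 7) + s powi (- a) * theta0 s L (a - 1) (b - 7))"
proof -
  have "theta1 s (Suc L) a b
      = 1 * (s powi (0 * a) * theta1 s L (a + 0) (b + 7 * 0))
        + s ^ Suc L * (s powi (1 * a) * theta0 s L (a + 1) (b + 7 * 1))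
        + s ^ Suc L * (s powi ((-1) * a) * theta0 s L (a + (-1)) (b + 7 * (-1)))"
    by (intro theta_linear s_nonzero finite_supports, subst T1_Suc[OF s])
       (use s_nonzero in \<open>simp add: power_int_add power_int_diff power_int_minus divide_inverse\<close>)
  then show ?thesis by (simp add: algebra_simps)
qed

lemma theta0_Suc:
  "theta0 s (Suc L) a b = theta0 s L (a - 1) b + s ^ Suc L * s powi a * theta1 s L a (b + 7)
    + s ^ (2 * Suc L) * s powi (2 * a) * theta0 s L (a + 1) (b + 14)"
proof -
  have E: "s powi (2 * (int (Suc L) + A)) = s ^ (2 * Suc L) * s powi (2 * A)" for A
    using s_nonzero by (subst powi_nat_mult) (simp_all add: algebra_simps)
  have "theta0 s (Suc L) a b
      = 1 * (s powi (0 * a) * theta0 s L (a + (-1)) (b + 7 * 0))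
        + s ^ Suc L * (s powi (1 * a) * theta1 s L (a + 0) (b + 7 * 1))
        + s ^ (2 * Suc L) * (s powi (2 * a) * theta0 s L (a + 1) (b + 7 * 2))"
    by (intro theta_linear s_nonzero finite_supports, subst T0_Suc[OF s], unfold E)
       (use s_nonzero in \<open>simp add: power_int_add\<close>)
  then show ?thesis by (simp add: algebra_simps)
qed

lemma theta0_Suc_theta1_Suc:
  "theta0 s (Suc L) a b = s ^ Suc L * s powi a * theta1 s (Suc L) (a + 1) (b + 7)
    + theta0 s L (a - 1) b - s ^ (2 * L + 3) * s powi (2 * a) * theta0 s L (a + 2) (b + 14)"
proof -
  have E: "s powi (2 * (int (Suc L) + A) + 1) = s ^ (2 * L + 3) * s powi (2 * A)" for A
    using s_nonzero by (subst powi_nat_mult) (simp_all add: algebra_simps)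
  have "theta0 s (Suc L) a b
      = s ^ Suc L * (s powi (1 * a) * theta1 s (Suc L) (a + 1) (b + 7 * 1))
        + 1 * (s powi (0 * a) * theta0 s L (a + (-1)) (b + 7 * 0))
        + (- (s ^ (2 * L + 3))) * (s powi (2 * a) * theta0 s L (a + 2) (b + 7 * 2))"
    by (intro theta_linear s_nonzero finite_supports, subst T0_Suc_T1_Suc[OF s], unfold E)
       (use s_nonzero in \<open>simp add: power_int_add\<close>)
  then show ?thesis by (simp add: algebra_simps)
qed

lemma theta1_theta0_consecutive:
  "theta1 s L a b = theta1 s L (a + 1) b
    + s ^ L * (s powi (- a) * theta0 s L a (b - 7) - s * s powi a * theta0 s L (a + 1) (b + 7))"
proof -
  have "theta1 s L a b
      = 1 * (s powi (0 * a) * theta1 s L (a + 1) (b + 7 * 0))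
        + s ^ L * (s powi ((-1) * a) * theta0 s L (a + 0) (b + 7 * (-1)))
        + (- (s ^ Suc L)) * (s powi (1 * a) * theta0 s L (a + 1) (b + 7 * 1))"
    apply (intro theta_linear s_nonzero finite_supports)
    subgoal for A
      using T1_T0_consecutive[OF s, of L A] s_nonzero
      by (simp add: power_int_add power_int_diff power_int_minus field_simps)
    done
  then show ?thesis by (simp add: algebra_simps)
qed

lemma theta0_minus: "theta0 s L (- a) (- b) = theta0 s L a b"
  by (intro theta_minus T0_minus)

lemma theta1_minus: "theta1 s L (- a) (- b) = theta1 s L a b"
  by (intro theta_minus T1_minus)

text \<open>
  The mirror images under \<open>A \<mapsto> -A\<close>. Of the two parts of \<open>bose_T0\<close> and \<open>bose_T0'\<close> below, one is expanded
  by a relation and the other by its mirror image: with this choice the correction terms of the two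
  parts meet at the same residues modulo 7.
\<close>

lemma theta0_Suc':
  "theta0 s (Suc L) a b = theta0 s L (a + 1) b + s ^ Suc L * s powi (- a) * theta1 s L a (b - 7)
    + s ^ (2 * Suc L) * s powi (- 2 * a) * theta0 s L (a - 1) (b - 14)"
proof -
  have I: "- a - 1 = - (a + 1)" "- a + 1 = - (a - 1)" "- b + 7 = - (b - 7)"
    "- b + 14 = - (b - 14)" "2 * - a = - 2 * a"
    by simp_all
  show ?thesis
    using theta0_Suc[of "- a" "- b" L] unfolding I theta0_minus theta1_minus .
qed

lemma theta0_Suc_theta1_Suc':
  "theta0 s (Suc L) a b = s ^ Suc L * s powi (- a) * theta1 s (Suc L) (a - 1) (b - 7)
    + theta0 s L (a + 1) b - s ^ (2 * L + 3) * s powi (- 2 * a) * theta0 s L (a - 2) (b - 14)"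
proof -
  have I: "- a - 1 = - (a + 1)" "- a + 1 = - (a - 1)" "- a + 2 = - (a - 2)"
    "- b + 7 = - (b - 7)" "- b + 14 = - (b - 14)" "2 * - a = - 2 * a"
    by simp_all
  show ?thesis
    using theta0_Suc_theta1_Suc[of "- a" "- b" L] unfolding I theta0_minus theta1_minus .
qed

text \<open>
  The weight of \<open>T1 L A\<close> in \<open>bose\<close> is \<open>s^((3A^2 - A - 2)/7)\<close>, after replacing \<open>A = 7k + 3\<close> by its
  negative. It occurs with sign \<open>+\<close> for \<open>A \<equiv> 1\<close> and \<open>-\<close> for \<open>A \<equiv> 4\<close> modulo 7, the two classes in
  which the exponent is an integer. In the same way, with \<open>A = 7k + 4\<close>
  replaced by its negative, \<open>bose_T0\<close> has the exponent \<open>(3A^2 - 2A)/7\<close> on the classes \<open>0\<close> and \<open>3\<close>.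
  The auxiliary \<open>bose_T0'\<close> is the leftover of \<open>bose_T0\<close> after one step in \<open>L\<close>.
\<close>

definition bose :: "nat \<Rightarrow> 'a" where
  "bose L = theta1 s L 1 5 - s ^ 4 * theta1 s L 3 19"

definition bose_T0 :: "nat \<Rightarrow> 'a" where
  "bose_T0 L = theta0 s L 0 (- 2) - s ^ 8 * theta0 s L 4 26"

definition bose_T0' :: "nat \<Rightarrow> 'a" where
  "bose_T0' L = theta0 s L (- 1) (- 2) - s ^ 8 * theta0 s L 5 26"

text \<open>In the next two lemmas, both parts produce the same multiple of \<open>theta0 s L 2 12\<close>, which cancels.\<close>

lemma bose_Suc: "bose (Suc L) = bose L + s ^ L * bose_T0 L"
  using s_nonzero
  by (simp add: bose_def bose_T0_def theta1_Suc power_int_minus field_simps eval_nat_numeral)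

lemma bose_T0_Suc: "bose_T0 (Suc L) = s ^ Suc L * bose (Suc L) + bose_T0' L"
proof -
  have e1: "theta0 s (Suc L) 0 (- 2) = s ^ Suc L * theta1 s (Suc L) 1 5 + theta0 s L (- 1) (- 2)
      - s ^ (2 * L + 3) * theta0 s L 2 12"
    using theta0_Suc_theta1_Suc[of 0 "- 2" L] by simp
  have e2: "s ^ 8 * theta0 s (Suc L) 4 26 = s ^ (L + 5) * theta1 s (Suc L) 3 19
      + s ^ 8 * theta0 s L 5 26 - s ^ (2 * L + 3) * theta0 s L 2 12"
  proof -
    have "s ^ 8 * theta0 s (Suc L) 4 26 = s ^ Suc L * (s ^ 8 * s powi (- 4)) * theta1 s (Suc L) 3 19
        + s ^ 8 * theta0 s L 5 26 - s ^ (2 * L + 3) * (s ^ 8 * s powi (- 8)) * theta0 s L 2 12"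
      unfolding theta0_Suc_theta1_Suc'[of 4 26 L] by (simp add: algebra_simps)
    also have "s ^ 8 * s powi (- 4) = s ^ 4"
      by (simp add: powi_nat_mult[OF s_nonzero])
    also have "s ^ 8 * s powi (- 8) = 1"
      by (simp add: powi_nat_mult[OF s_nonzero])
    finally show ?thesis by (simp add: power_add eval_nat_numeral)
  qed
  show ?thesis
    unfolding bose_def bose_T0_def bose_T0'_def e1 e2
    by (simp add: algebra_simps power_add eval_nat_numeral)
qed

text \<open>
  The correction terms at residues \<open>5\<close> and \<open>6\<close> cancel because the difference of the two \<open>T1\<close> sums
  that appear is, by \<open>T1_T0_consecutive\<close>, a power of \<open>s\<close> times the difference of the two \<open>T0\<close> sums.
\<close>

lemma bose_T0'_Suc: "bose_T0' (Suc L) = bose_T0 L"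
proof -
  \<comment> \<open>The lowered residues \<open>-2\<close> and \<open>-1\<close> must be compared with \<open>5\<close> and \<open>6\<close> from the other part.\<close>
  have p: "theta0 s L (- 2) (- 16) = s ^ 5 * theta0 s L 5 26"
    "theta1 s L (- 1) (- 9) = s ^ 12 * theta1 s L 6 33"
    using theta_period[OF s_nonzero T0_finite_support, of "- 2" "- 16" L]
      theta_period[OF s_nonzero T1_finite_support, of "- 1" "- 9" L] by simp_all
  have "theta0 s (Suc L) (- 1) (- 2) = theta0 s L 0 (- 2) + s ^ (L + 14) * theta1 s L 6 33
      + s ^ (2 * L + 9) * theta0 s L 5 26"
    using theta0_Suc'[of "- 1" "- 2" L] by (simp add: p power_add mult_2 eval_nat_numeral)
  moreover have "s ^ 8 * theta0 s (Suc L) 5 26 = s ^ 8 * theta0 s L 4 26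
      + s ^ (L + 14) * theta1 s L 5 33 + s ^ (2 * L + 20) * theta0 s L 6 40"
    using theta0_Suc[of 5 26 L] by (simp add: power_add mult_2 eval_nat_numeral algebra_simps)
  moreover have "s ^ (L + 14) * theta1 s L 5 33 = s ^ (L + 14) * theta1 s L 6 33
      + s ^ (2 * L + 9) * theta0 s L 5 26 - s ^ (2 * L + 20) * theta0 s L 6 40"
  proof -
    have "s ^ (L + 14) * theta1 s L 5 33 = s ^ (L + 14) * theta1 s L 6 33
        + s ^ (2 * L) * (s ^ 14 * s powi (- 5)) * theta0 s L 5 26
        - s ^ (2 * L + 15) * s ^ 5 * theta0 s L 6 40"
      unfolding theta1_theta0_consecutive[of 5 33 L]
      by (simp add: power_add mult_2 algebra_simps eval_nat_numeral)
    also have "s ^ 14 * s powi (- 5) = s ^ 9"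
      by (simp add: powi_nat_mult[OF s_nonzero])
    finally show ?thesis by (simp add: add.commute flip: power_add)
  qed
  ultimately show ?thesis
    by (simp add: bose_T0_def bose_T0'_def)
qed

lemma T0_0: "T0 0 A s = (if A = 0 then 1 else 0)"
  using s by (cases A "0 :: int" rule: linorder_cases) (simp_all add: T0_def generic_power2 gauss_binom_outside)

lemma T1_0: "T1 0 A s = (if A = 0 then 1 else 0)"
  using s by (cases A "0 :: int" rule: linorder_cases) (simp_all add: T1_def generic_power2 gauss_binom_outside)

lemma theta_delta:
  "theta s a b (\<lambda>A. if A = 0 then 1 else 0) = (if a = 0 then 1 else 0)" if "\<bar>a\<bar> < 7"
proof -
  have "7 * k + a = 0 \<longleftrightarrow> k = 0 \<and> a = 0" for k
    using that by presburger
  then have "theta s a b (\<lambda>A. if A = 0 then 1 else 0)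
      = Sum_any (\<lambda>k::int. if k = 0 then (if a = 0 then 1 else 0) else 0)"
    unfolding theta_def by (intro Sum_any.cong) auto
  then show ?thesis by simp
qed

lemma bose_0: "bose 0 = 0" "bose_T0 0 = 1" "bose_T0' 0 = 0"
  by (simp_all add: bose_def bose_T0_def bose_T0'_def T0_0 T1_0 theta_delta)

lemma bose_rec:
  "bose (n + 4) = (1 + s ^ (2 * (n + 3))) * bose (n + 3) + s ^ 2 * bose (n + 2) - s ^ 2 * bose (n + 1)"
proof -
  have "bose (n + 4) = bose (n + 3) + s ^ (n + 3) * bose_T0 (n + 3)"
    using bose_Suc[of "n + 3"] by (simp add: eval_nat_numeral)
  also have "bose_T0 (n + 3) = s ^ (n + 3) * bose (n + 3) + bose_T0 (n + 1)"
    using bose_T0_Suc[of "n + 2"] bose_T0'_Suc[of "n + 1"] by (simp add: eval_nat_numeral)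
  also have "s ^ (n + 3) * (s ^ (n + 3) * bose (n + 3) + bose_T0 (n + 1))
      = s ^ (2 * (n + 3)) * bose (n + 3) + s ^ 2 * (s ^ (n + 1) * bose_T0 (n + 1))"
    by (simp add: algebra_simps eval_nat_numeral power_add mult_2)
  also have "s ^ (n + 1) * bose_T0 (n + 1) = bose (n + 2) - bose (n + 1)"
    using bose_Suc[of "n + 1"] by (simp add: eval_nat_numeral)
  finally show ?thesis by (simp add: algebra_simps)
qed

lemma bose_init:
  "bose 1 = 1" "bose 2 = s ^ 2 + 1" "bose 3 = s ^ 6 + s ^ 4 + 2 * s ^ 2 + 1"
proof -
  show b1: "bose 1 = 1"
    using bose_Suc[of 0] by (simp add: bose_0)
  have g1: "bose_T0 1 = s"
    using bose_T0_Suc[of 0] b1 by (simp add: bose_0)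
  show b2: "bose 2 = s ^ 2 + 1"
    using bose_Suc[of 1] b1 g1 by (simp add: eval_nat_numeral)
  have "bose_T0 2 = s ^ 2 * bose 2 + 1"
    using bose_T0_Suc[of 1] bose_T0'_Suc[of 0] by (simp add: bose_0 eval_nat_numeral)
  then show "bose 3 = s ^ 6 + s ^ 4 + 2 * s ^ 2 + 1"
    using bose_Suc[of 2] b2 by (simp add: eval_nat_numeral algebra_simps)
qed

lemma bose_eq_Sum_any:
  "bose L = Sum_any (\<lambda>k::int.
      s\<^sup>2 powi ((21 * k\<^sup>2 + 5 * k) div 2) * T1 L (7 * k + 1) s
      - s\<^sup>2 powi (((21 * k + 19) * k) div 2 + 2) * T1 L (7 * k + 3) s)"
proof -
  have dbl: "s\<^sup>2 powi i = s powi (2 * i)" for i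
    by (simp add: power_int_mult)
  have e1: "s\<^sup>2 powi ((21 * k\<^sup>2 + 5 * k) div 2) = s powi (21 * k\<^sup>2 + 5 * k)" for k :: int
  proof -
    have "even (21 * k\<^sup>2 + 5 * k)" by simp
    then show ?thesis unfolding dbl by (simp only: dvd_mult_div_cancel)
  qed
  have e2: "s\<^sup>2 powi (((21 * k + 19) * k) div 2 + 2) = s ^ 4 * s powi (21 * k\<^sup>2 + 19 * k)" for k :: int
  proof -
    have "even ((21 * k + 19) * k)" by simp
    then have "2 * (((21 * k + 19) * k) div 2 + 2) = int 4 + (21 * k\<^sup>2 + 19 * k)"
      by (simp only: distrib_left dvd_mult_div_cancel) (simp add: algebra_simps power2_eq_square)
    then show ?thesis unfolding dbl by (simp only: powi_nat_mult[OF s_nonzero])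
  qed
  let ?f = "\<lambda>k. s powi (21 * k\<^sup>2 + 5 * k) * T1 L (7 * k + 1) s"
  let ?g = "\<lambda>k. s powi (21 * k\<^sup>2 + 19 * k) * T1 L (7 * k + 3) s"
  have fin: "finite {k. ?f k \<noteq> 0}" "finite {k. ?g k \<noteq> 0}"
    by (intro theta_finite_support T1_finite_support)+
  have "bose L = Sum_any ?f + - (s ^ 4) * Sum_any ?g"
    by (simp add: bose_def theta_def)
  also have "\<dots> = Sum_any (\<lambda>k. ?f k + - (s ^ 4) * ?g k)"
    unfolding Sum_any_right_distrib[OF fin(2)]
    by (intro Sum_any.distrib[symmetric] fin finite_subset[OF _ fin(2)]) auto
  finally show ?thesis by (simp add: e1 e2 mult.assoc)
qed

end

section \<open>The recurrence for the double sum\<close>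

text \<open>
  Here \<open>n\<close> is an integer and both sums run up to a fixed \<open>N\<close>. Hence the terms with index \<open>n - 1\<close>,
  \<open>n - 2\<close>, \<open>n - 3\<close> are sums over the same range, and vanish for negative index; the values
  at \<open>1\<close> and \<open>2\<close> then come from the recurrence too.
\<close>

definition fermi_term :: "'a::field \<Rightarrow> int \<Rightarrow> nat \<Rightarrow> nat \<Rightarrow> 'a" where
  "fermi_term q n j k = q ^ (j * (j + 1) div 2 + k) * gauss_binom (q\<^sup>2) (int (j + k)) (int k)
     * gauss_binom q (n - 2 * int k) (int j)"

definition fermi :: "'a::field \<Rightarrow> nat \<Rightarrow> int \<Rightarrow> 'a" where
  "fermi q N n = (\<Sum>j\<le>N. \<Sum>k\<le>N. fermi_term q n j k)"

lemma fermi_term_eq_0: "int j > n \<or> 2 * int k > n \<Longrightarrow> fermi_term q n j k = 0"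
  by (auto simp: fermi_term_def gauss_binom_def)

lemma Pn_eq_fermi:
  assumes "n \<le> N"
  shows "Pn q n = fermi q N (int n)"
proof -
  have inner: "Sum_any (\<lambda>k. fermi_term q (int n) j k) = (\<Sum>k\<le>N. fermi_term q (int n) j k)" for j
    using assms by (intro Sum_any.expand_superset) (auto intro!: fermi_term_eq_0 simp: not_le[symmetric])
  have "Pn q n = Sum_any (\<lambda>j. Sum_any (\<lambda>k. fermi_term q (int n) j k))"
    by (simp add: Pn_def fermi_term_def)
  also have "\<dots> = fermi q N (int n)"
    unfolding inner fermi_def using assms
    by (intro Sum_any.expand_superset)
       (auto intro!: fermi_term_eq_0 sum.neutral simp: not_le[symmetric])
  finally show ?thesis .
qed

lemma fermi_neg: "n < 0 \<Longrightarrow> fermi q N n = 0"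
  by (auto simp: fermi_def intro!: sum.neutral fermi_term_eq_0)

text \<open>
  The first difference \<open>S n j - S (n - 1) j\<close> replaces the base-\<open>q\<close> factor by its difference \<open>\<delta>\<close>
  (the factor \<open>1 - x\<close> of the generating function); the second one acts, after \<open>k\<close> is shifted by one,
  on the base-\<open>q^2\<close> factor only (the factor \<open>1 - q x^2\<close>). Pascal's rule applies to both and lowers \<open>j\<close>.
  The index \<open>n = 0\<close> is exceptional and accounts for the constant \<open>1\<close> in the functional equation.
\<close>

lemma fermi_term_rec:
  assumes q: "generic q" and n: "n \<noteq> 0" "n \<le> int N"
  defines "S \<equiv> \<lambda>n j. \<Sum>k\<le>N. fermi_term q n j k"
  shows "S n j - S (n - 1) j - q * (S (n - 2) j - S (n - 3) j)
    = (if j = 0 then 0 else q powi n * S (n - 1) (j - 1))"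
proof -
  define \<delta> where "\<delta> m = gauss_binom q m (int j) - gauss_binom q (m - 1) (int j)" for m
  define c where "c k = q ^ (j * (j + 1) div 2 + k)" for k
  define F where "F k = c k * gauss_binom (q\<^sup>2) (int (j + k) - 1) (int k - 1) * \<delta> (n - 2 * int k)" for k
  have diff: "S m j - S (m - 1) j
      = (\<Sum>k\<le>N. c k * gauss_binom (q\<^sup>2) (int (j + k)) (int k) * \<delta> (m - 2 * int k))" for m
    unfolding S_def sum_subtractf[symmetric] fermi_term_def \<delta>_def c_def
    by (intro sum.cong refl) (simp add: algebra_simps)
  have "q * (S (n - 2) j - S (n - 3) j) = (\<Sum>k\<le>N. F (Suc k))"
    using diff[of "n - 2"] unfolding F_def c_def
    by (simp add: sum_distrib_left algebra_simps)
  also have "\<dots> = (\<Sum>k\<le>Suc N. F k)"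
    by (subst sum.atMost_Suc_shift) (simp add: F_def gauss_binom_outside)
  also have "\<dots> = (\<Sum>k\<le>N. F k)"
    using n by (simp add: F_def \<delta>_def gauss_binom_outside)
  finally have "S n j - S (n - 1) j - q * (S (n - 2) j - S (n - 3) j)
     = (\<Sum>k\<le>N. c k * (gauss_binom (q\<^sup>2) (int (j + k)) (int k)
          - gauss_binom (q\<^sup>2) (int (j + k) - 1) (int k - 1)) * \<delta> (n - 2 * int k))"
    unfolding diff[of n] sum_subtractf[symmetric] F_def
    by (simp add: sum_subtractf[symmetric] algebra_simps)
  also have "\<dots> = (if j = 0 then 0 else q powi n * S (n - 1) (j - 1))"
  proof (cases j)
    case 0
    have "(gauss_binom (q\<^sup>2) (int (j + k)) (int k)
          - gauss_binom (q\<^sup>2) (int (j + k) - 1) (int k - 1)) * \<delta> (n - 2 * int k) = 0" for k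
    proof (cases k)
      case 0
      then show ?thesis
        using \<open>j = 0\<close> n q by (cases "n > 0") (auto simp: \<delta>_def gauss_binom_outside)
    next
      case (Suc l)
      then show ?thesis
        using \<open>j = 0\<close> gauss_binom_self[OF generic_power2[OF q], of "int k"]
          gauss_binom_self[OF generic_power2[OF q], of "int l"] by simp
    qed
    then have "c k * (gauss_binom (q\<^sup>2) (int (j + k)) (int k)
          - gauss_binom (q\<^sup>2) (int (j + k) - 1) (int k - 1)) * \<delta> (n - 2 * int k) = 0" for k
      by (simp only: mult.assoc mult_zero_right)
    then show ?thesis unfolding if_P[OF 0] by (intro sum.neutral ballI)
  next
    case (Suc i)
    have "c k * (gauss_binom (q\<^sup>2) (int (j + k)) (int k)
          - gauss_binom (q\<^sup>2) (int (j + k) - 1) (int k - 1)) * \<delta> (n - 2 * int k)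
        = q powi n * fermi_term q (n - 1) i k" for k
    proof -
      have 1: "gauss_binom (q\<^sup>2) (int (j + k)) (int k) - gauss_binom (q\<^sup>2) (int (j + k) - 1) (int k - 1)
          = q ^ (2 * k) * gauss_binom (q\<^sup>2) (int (i + k)) (int k)"
        using gauss_binom_pascal'[OF generic_power2[OF q], of "int (j + k)" "int k"] Suc
        by (simp add: algebra_simps flip: power_mult)
      have 2: "\<delta> m = q powi (m - int j) * gauss_binom q (m - 1) (int i)" for m
      proof (cases "m \<ge> 1")
        case True
        then show ?thesis
          using gauss_binom_pascal[OF q, of m "int j"] Suc by (simp add: \<delta>_def)
      next
        case False
        then show ?thesis using Suc by (simp add: \<delta>_def gauss_binom_outside)
      qed
      have 3: "j * (j + 1) div 2 = i * (i + 1) div 2 + j"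
        unfolding Suc by simp
      have "q ^ (i * (i + 1) div 2 + j + k) * (q ^ (2 * k) * q powi (n - 2 * int k - int j))
          = q ^ (i * (i + 1) div 2 + k) * q powi n"
        by (simp only: powi_nat_mult[OF generic_nonzero[OF q]]) (simp add: algebra_simps)
      then show ?thesis
        unfolding 1 2 fermi_term_def c_def 3 by (simp add: algebra_simps)
    qed
    then show ?thesis using Suc by (simp add: S_def sum_distrib_left)
  qed
  finally show ?thesis .
qed

lemma fermi_rec:
  assumes q: "generic q" and n: "n \<noteq> 0" "n \<le> int N"
  shows "fermi q N n = (1 + q powi n) * fermi q N (n - 1) + q * fermi q N (n - 2) - q * fermi q N (n - 3)"
proof -
  let ?S = "\<lambda>n j. \<Sum>k\<le>N. fermi_term q n j k"
  have "fermi q N n - fermi q N (n - 1) - q * (fermi q N (n - 2) - fermi q N (n - 3))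
      = (\<Sum>j\<le>N. ?S n j - ?S (n - 1) j - q * (?S (n - 2) j - ?S (n - 3) j))"
    by (simp add: fermi_def sum_subtractf flip: sum_distrib_left)
  also have "\<dots> = (\<Sum>j\<le>N. if j = 0 then 0 else q powi n * ?S (n - 1) (j - 1))"
    using fermi_term_rec[OF assms] by (intro sum.cong refl)
  \<comment> \<open>The added summand \<open>j = N + 1\<close> involves \<open>[n - 1 - 2k, N]\<close> with \<open>n - 1 < N\<close>, hence vanishes.\<close>
  also have "\<dots> = (\<Sum>j\<le>Suc N. if j = 0 then 0 else q powi n * ?S (n - 1) (j - 1))"
    using n by (simp add: fermi_term_eq_0)
  also have "\<dots> = q powi n * fermi q N (n - 1)"
    by (subst sum.atMost_Suc_shift) (simp add: fermi_def sum_distrib_left)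
  finally show ?thesis by (simp add: algebra_simps)
qed

lemma Pn_rec:
  assumes "generic q" "n \<ge> 3"
  shows "Pn q n = (1 + q ^ n) * Pn q (n - 1) + q * Pn q (n - 2) - q * Pn q (n - 3)"
  using fermi_rec[OF assms(1), of "int n" n] assms(2)
  by (simp add: Pn_eq_fermi[of _ n] of_nat_diff)

lemma Pn_init:
  assumes "generic q"
  shows "Pn q 0 = 1" "Pn q 1 = q + 1" "Pn q 2 = q ^ 3 + q ^ 2 + 2 * q + 1"
proof -
  show P0: "Pn q 0 = 1"
    using assms generic_power2[OF assms]
    by (simp add: Pn_eq_fermi[of 0 0] fermi_def fermi_term_def)
  show P1: "Pn q 1 = q + 1"
    using fermi_rec[OF assms, of 1 1] P0 by (simp add: Pn_eq_fermi[of _ 1] fermi_neg)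
  show "Pn q 2 = q ^ 3 + q ^ 2 + 2 * q + 1"
    using fermi_rec[OF assms, of 2 2] P0 P1
    by (simp add: Pn_eq_fermi[of _ 2] fermi_neg algebra_simps eval_nat_numeral)
qed

section \<open>Comparison\<close>

lemma Pn_eq_bose:
  assumes s: "generic s"
  shows "Pn (s\<^sup>2) n = bose s (n + 1)"
proof (induction n rule: less_induct)
  case (less n)
  note q = generic_power2[OF s]
  have "n = 0 \<or> n = 1 \<or> n = 2 \<or> n = (n - 3) + 3" by presburger
  then consider "n = 0" | "n = 1" | "n = 2" | m where "n = m + 3" by blast
  then show ?case
  proof cases
    case 4
    have "Pn (s\<^sup>2) (n - 1) = bose s n" "Pn (s\<^sup>2) (n - 2) = bose s (m + 2)"
      "Pn (s\<^sup>2) (n - 3) = bose s (m + 1)"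
      using less.IH[of "n - 1"] less.IH[of "n - 2"] less.IH[of "n - 3"] 4
      by (simp_all add: eval_nat_numeral)
    then have "Pn (s\<^sup>2) n = (1 + (s\<^sup>2) ^ n) * bose s n + s\<^sup>2 * bose s (m + 2) - s\<^sup>2 * bose s (m + 1)"
      using Pn_rec[OF q, of n] 4 by simp
    then show ?thesis
      using bose_rec[OF s, of m] 4 by (simp add: add.commute[of 4] flip: power_mult)
  qed (use Pn_init[OF q] bose_init[OF s] in \<open>simp_all add: eval_nat_numeral algebra_simps\<close>)
qed

lemma generic_sqrtq: "generic sqrtq"
proof -
  have "[:0, 1:] ^ n \<noteq> (1 :: rat poly)" if "n > 0" for n
  proof
    assume "[:0, 1:] ^ n = (1 :: rat poly)"
    then have "degree ([:0, 1 :: rat:] ^ n) = 0" by simp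
    then show False using that by (simp add: degree_power_eq)
  qed
  moreover have "sqrtq ^ n = to_fract ([:0, 1:] ^ n)" for n
    by (induction n) (simp_all only: sqrtq_def power_0 power_Suc to_fract_1 to_fract_mult)
  ultimately show ?thesis
    by (auto simp: generic_def sqrtq_def simp flip: to_fract_1)
qed

theorem mainTheorem15:
  shows "(\<forall>n::nat. Pn indet_q n =
            Sum_any (\<lambda>k::int.
              indet_q powi ((21 * k\<^sup>2 + 5 * k) div 2) * T1 (n + 1) (7 * k + 1) sqrtq
              - indet_q powi (((21 * k + 19) * k) div 2 + 2) * T1 (n + 1) (7 * k + 3) sqrtq))
       \<and> Pn indet_q 0 = 1
       \<and> Pn indet_q 1 = indet_q + 1
       \<and> Pn indet_q 2 = indet_q ^ 3 + indet_q ^ 2 + 2 * indet_q + 1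
       \<and> (\<forall>n::nat. n \<ge> 3 \<longrightarrow>
            Pn indet_q n = (1 + indet_q ^ n) * Pn indet_q (n - 1)
              + indet_q * Pn indet_q (n - 2) - indet_q * Pn indet_q (n - 3))"
proof -
  have q: "generic indet_q"
    unfolding indet_q_def by (rule generic_power2[OF generic_sqrtq])
  have "Pn indet_q n = Sum_any (\<lambda>k::int.
              indet_q powi ((21 * k\<^sup>2 + 5 * k) div 2) * T1 (n + 1) (7 * k + 1) sqrtq
              - indet_q powi (((21 * k + 19) * k) div 2 + 2) * T1 (n + 1) (7 * k + 3) sqrtq)" for n
    unfolding indet_q_def Pn_eq_bose[OF generic_sqrtq] bose_eq_Sum_any[OF generic_sqrtq] ..
  then show ?thesis
    using Pn_init[OF q] Pn_rec[OF q] by (intro conjI allI impI)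
qed

end
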